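(* Fix an integer $m \geq 1$ (not depending on $d$) and a probability distribution $\mathcal{D}$ on $\mathbb{R}$ with mean zero (not depending on $d$). For each dimension $d$, let $\mathcal{X} = \{x^{(1)}, \ldots, x^{(m)}\} \subset \mathbb{R}^d$ be a collection of $m$ random vectors whose $md$ coordinates are independent and identically distributed according to $\mathcal{D}$. Then for any $u \in \mathcal{X}$, $$\lim_{d \to \infty} \Pr\Big[ u = \arg\max_{v \in \mathcal{X}} \langle u, v \rangle \Big] = 1,$$ i.e., the probability that $u$ attains the maximum of $v \mapsto \langle u, v\rangle$ over $v \in \mathcal{X}$ tends to $1$.
   Context: $\langle u, v\rangle = \sum_{i=1}^d u_i v_i$ denotes the standard inner product on $\mathbb{R}^d$. *)

theory Defs
  imports "HOL-Probability.Probability"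
begin

text \<open>Since the dimension \<^term>\<open>d\<close> tends to infinity inside the statement, vectors in
  \<open>\<real>\<^sup>d\<close> are rendered as extensional functions in \<^term>\<open>{1..d::nat} \<rightarrow>\<^sub>E (UNIV :: real set)\<close>.\<close>

definition inner_Rd :: "nat \<Rightarrow> (nat \<Rightarrow> real) \<Rightarrow> (nat \<Rightarrow> real) \<Rightarrow> real" where
  "inner_Rd d u v = (\<Sum>j = 1..d. u j * v j)"

definition vec_Rd :: "nat \<Rightarrow> (nat \<Rightarrow> real) \<Rightarrow> nat \<Rightarrow> real" where
  "vec_Rd d x = (\<lambda>j\<in>{1..d}. x j)"

end

theory Submission
  imports Defs
begin

text \<open>Fix a competitor \<open>v \<noteq> u\<close>. The difference \<open>\<langle>u, u\<rangle> - \<langle>u, v\<rangle>\<close> is at least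
  \<open>\<Sum>j. min (u\<^sub>j\<^sup>2) 1 - u\<^sub>j v\<^sub>j\<close>, a sum of i.i.d. integrable terms whose mean
  \<open>E (min (u\<^sub>j\<^sup>2) 1) - E u\<^sub>j E v\<^sub>j\<close> is positive unless \<open>u\<close> vanishes almost surely, in which case
  all inner products with \<open>u\<close> are \<open>0\<close>. The cut-off at \<open>1\<close> is what makes the mean finite, as no second moment is assumed. By the weak law of
  large numbers this sum is negative with vanishing probability, and a union bound over
  the finitely many competitors finishes the proof.\<close>

section \<open>Pairwise independence and transfer of expectations to a law\<close>

lemma (in prob_space) indep_var_of_indep_vars:
  assumes "indep_vars M' X I" "a \<in> I" "b \<in> I" "a \<noteq> b"
  shows "indep_var (M' a) (X a) (M' b) (X b)"
proof -
  have "indep_var (M' a) ((\<lambda>f. f a) \<circ> (\<lambda>\<omega>. \<lambda>i\<in>{a}. X i \<omega>)) (M' b) ((\<lambda>f. f b) \<circ> (\<lambda>\<omega>. \<lambda>i\<in>{b}. X i \<omega>))"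
    by (rule indep_var_compose[OF indep_var_restrict[OF assms(1), of "{a}" "{b}"]])
       (use assms in \<open>auto intro: measurable_component_singleton\<close>)
  then show ?thesis
    by (simp add: comp_def)
qed

text \<open>The assumptions on the coordinates describe only their laws, so integrability and
  expectations of functions of a coordinate are computed by passing to the image measure.\<close>

lemma
  fixes f :: "real \<Rightarrow> real"
  assumes "X \<in> borel_measurable M" "distr M borel X = N" "f \<in> borel_measurable borel"
  shows integrable_iff_of_distr: "integrable M (\<lambda>\<omega>. f (X \<omega>)) \<longleftrightarrow> integrable N f"
    and integral_eq_of_distr: "(\<integral>\<omega>. f (X \<omega>) \<partial>M) = (\<integral>t. f t \<partial>N)"
  using assms(1,3) unfolding assms(2)[symmetric] by (simp_all add: integrable_distr_eq integral_distr)

lemmas integrable_iff_of_distr_ident =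
    integrable_iff_of_distr[where f = "\<lambda>t. t", OF _ _ measurable_ident_sets[OF refl]]
  and integral_eq_of_distr_ident =
    integral_eq_of_distr[where f = "\<lambda>t. t", OF _ _ measurable_ident_sets[OF refl]]

section \<open>Moment bounds for independent sums and the weak law of large numbers\<close>

lemma (in prob_space) expectation_abs_le_sqrt:
  fixes X :: "'a \<Rightarrow> real"
  assumes "integrable M X" "integrable M (\<lambda>\<omega>. (X \<omega>)\<^sup>2)"
  shows "expectation (\<lambda>\<omega>. \<bar>X \<omega>\<bar>) \<le> sqrt (expectation (\<lambda>\<omega>. (X \<omega>)\<^sup>2))"
proof (rule real_le_rsqrt)
  show "(expectation (\<lambda>\<omega>. \<bar>X \<omega>\<bar>))\<^sup>2 \<le> expectation (\<lambda>\<omega>. (X \<omega>)\<^sup>2)"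
    using variance_eq[of "\<lambda>\<omega>. \<bar>X \<omega>\<bar>"] variance_positive[of "\<lambda>\<omega>. \<bar>X \<omega>\<bar>"] assms by simp
qed

text \<open>The square expands into a double sum. Off the diagonal, independence makes each product
  integrable and factors its expectation into two zero means, so only the diagonal survives.\<close>

lemma (in prob_space)
  fixes Y :: "'i \<Rightarrow> 'a \<Rightarrow> real"
  assumes fin: "finite I" and ind: "indep_vars (\<lambda>_. borel) Y I"
    and int: "\<And>j. j \<in> I \<Longrightarrow> integrable M (Y j)"
    and int2: "\<And>j. j \<in> I \<Longrightarrow> integrable M (\<lambda>\<omega>. (Y j \<omega>)\<^sup>2)"
    and mean: "\<And>j. j \<in> I \<Longrightarrow> expectation (Y j) = 0"
  shows integrable_square_sum_indep: "integrable M (\<lambda>\<omega>. (\<Sum>j\<in>I. Y j \<omega>)\<^sup>2)"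
    and expectation_square_sum_indep:
      "expectation (\<lambda>\<omega>. (\<Sum>j\<in>I. Y j \<omega>)\<^sup>2) = (\<Sum>j\<in>I. expectation (\<lambda>\<omega>. (Y j \<omega>)\<^sup>2))"
proof -
  have eq: "(\<Sum>j\<in>I. Y j \<omega>)\<^sup>2 = (\<Sum>j\<in>I. \<Sum>k\<in>I. Y j \<omega> * Y k \<omega>)" for \<omega>
    by (simp add: power2_eq_square sum_product)
  have int_prod: "integrable M (\<lambda>\<omega>. Y j \<omega> * Y k \<omega>)" if "j \<in> I" "k \<in> I" for j k
    using that indep_var_integrable[OF indep_var_of_indep_vars[OF ind]] int int2[of j]
    by (cases "j = k") (auto simp: power2_eq_square)
  have "expectation (\<lambda>\<omega>. Y j \<omega> * Y k \<omega>) = (if k = j then expectation (\<lambda>\<omega>. (Y j \<omega>)\<^sup>2) else 0)"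
    if "j \<in> I" "k \<in> I" for j k
    using that indep_var_lebesgue_integral[OF indep_var_of_indep_vars[OF ind, of j k]] int mean
    by (cases "j = k") (auto simp: power2_eq_square)
  then show "expectation (\<lambda>\<omega>. (\<Sum>j\<in>I. Y j \<omega>)\<^sup>2) = (\<Sum>j\<in>I. expectation (\<lambda>\<omega>. (Y j \<omega>)\<^sup>2))"
    unfolding eq using int_prod fin by (simp add: Bochner_Integration.integral_sum)
  show "integrable M (\<lambda>\<omega>. (\<Sum>j\<in>I. Y j \<omega>)\<^sup>2)"
    unfolding eq using int_prod by (intro Bochner_Integration.integrable_sum)
qed

text \<open>Only a first moment is available, so the summands are split at level \<open>B\<close>: the bounded part
  is controlled in \<open>L\<^sup>2\<close>, the tail in \<open>L\<^sup>1\<close>.\<close>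

lemma (in prob_space) expectation_abs_centered_sum_le:
  fixes X :: "'i \<Rightarrow> 'a \<Rightarrow> real" and N :: "real measure" and B \<tau> :: real
  assumes fin: "finite I" and ind: "indep_vars (\<lambda>_. borel) X I"
    and distr: "\<And>j. j \<in> I \<Longrightarrow> distr M borel (X j) = N"
    and N: "real_distribution N" "integrable N (\<lambda>t. t)" and B: "B \<ge> 0"
  defines "\<tau> \<equiv> \<integral>t. \<bar>t\<bar> * indicator {t. \<bar>t\<bar> > B} t \<partial>N"
  shows "expectation (\<lambda>\<omega>. \<bar>\<Sum>j\<in>I. (X j \<omega> - (\<integral>t. t \<partial>N))\<bar>)
           \<le> 2 * B * sqrt (real (card I)) + 2 * real (card I) * \<tau>"
proof -
  interpret N: real_distribution N by fact
  have X[measurable]: "j \<in> I \<Longrightarrow> random_variable borel (X j)" for j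
    using ind by (auto simp: indep_vars_def)
  define h where "h t = t * indicator {t. \<bar>t\<bar> \<le> B} t" for t :: real
  define r where "r t = t * indicator {t. \<bar>t\<bar> > B} t" for t :: real
  have [measurable]: "h \<in> borel_measurable borel" "r \<in> borel_measurable borel"
    unfolding h_def r_def by measurable
  have h_bound: "\<bar>h t\<bar> \<le> B" for t
    using B by (auto simp: h_def indicator_def)
  have hr: "t = h t + r t" for t
    by (auto simp: h_def r_def indicator_def)
  have h_int: "integrable N h"
    by (rule N.integrable_const_bound[where B = B]) (use h_bound in auto)
  have r_int: "integrable N r"
    by (rule Bochner_Integration.integrable_bound[OF N(2)]) (auto simp: r_def indicator_def)
  have \<tau>: "\<tau> = (\<integral>t. \<bar>r t\<bar> \<partial>N)"
    unfolding \<tau>_def r_def by (simp add: abs_mult)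
  define a where "a = (\<integral>t. h t \<partial>N)"
  define b where "b = (\<integral>t. r t \<partial>N)"
  \<comment> \<open>The mean splits along with the variable, so the bounded part is centered by its
    own mean \<open>a\<close> and the tail by \<open>b\<close>.\<close>
  have ab: "(\<integral>t. t \<partial>N) = a + b"
    unfolding a_def b_def
    by (subst Bochner_Integration.integral_add[symmetric, OF h_int r_int]) (simp flip: hr)
  have a_bound: "\<bar>a\<bar> \<le> B"
  proof -
    have "\<bar>a\<bar> \<le> (\<integral>t. \<bar>h t\<bar> \<partial>N)"
      unfolding a_def by (rule integral_abs_bound)
    also have "\<dots> \<le> (\<integral>t. B \<partial>N)"
      by (rule integral_mono) (use h_int h_bound in auto)
    finally show ?thesis
      using N.prob_space by simp
  qed
  have b_bound: "\<bar>b\<bar> \<le> \<tau>"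
    unfolding b_def \<tau> by (rule integral_abs_bound)
  note transfer = integral_eq_of_distr[OF X distr] integrable_iff_of_distr[OF X distr]

  \<comment> \<open>\<open>?R\<close> majorizes the centered tail termwise through |r - b| \<le> |r|
    + |b|. Here |r| has expectation \<open>\<tau>\<close> and |b| is at most \<open>\<tau>\<close>,
    whence the factor 2 in the tail term.\<close>
  let ?H = "\<lambda>\<omega>. \<Sum>j\<in>I. (h (X j \<omega>) - a)" and ?R = "\<lambda>\<omega>. \<Sum>j\<in>I. (\<bar>r (X j \<omega>)\<bar> + \<bar>b\<bar>)"
  have centered:
    "indep_vars (\<lambda>_. borel) (\<lambda>j \<omega>. h (X j \<omega>) - a) I"
    by (rule indep_vars_compose2[OF ind]) measurable
  have int1: "integrable M (\<lambda>\<omega>. h (X j \<omega>) - a)" if "j \<in> I" for j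
    using transfer(2)[OF that that, of h] h_int by simp
  \<comment> \<open>Both \<open>h t\<close> and \<open>a\<close> lie in the interval from
    \<open>- B\<close> to \<open>B\<close>, so they differ by at most \<open>2 * B\<close>.\<close>
  have sq_le: "(h t - a)\<^sup>2 \<le> (2 * B)\<^sup>2" for t
    by (rule abs_le_square_iff[THEN iffD1]) (use h_bound[of t] a_bound in linarith)
  have int2: "integrable M (\<lambda>\<omega>. (h (X j \<omega>) - a)\<^sup>2)" if "j \<in> I" for j
    by (rule integrable_const_bound[where B = "(2 * B)\<^sup>2"]) (use sq_le that in auto)
  have mean: "expectation (\<lambda>\<omega>. h (X j \<omega>) - a) = 0" if "j \<in> I" for j
    using that transfer[OF that that, of h] h_int by (simp add: a_def prob_space)
  have H_int: "integrable M ?H"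
    using int1 by (intro Bochner_Integration.integrable_sum)
  \<comment> \<open>Passing through the second moment makes the cross terms cancel, so the bound
    grows like the square root of \<open>card I\<close> instead of \<open>card I\<close>
    itself.\<close>
  have "expectation (\<lambda>\<omega>. \<bar>?H \<omega>\<bar>) \<le> sqrt (expectation (\<lambda>\<omega>. (?H \<omega>)\<^sup>2))"
    by (intro expectation_abs_le_sqrt H_int integrable_square_sum_indep fin centered int1 int2 mean)
  also have "expectation (\<lambda>\<omega>. (?H \<omega>)\<^sup>2) = (\<Sum>j\<in>I. expectation (\<lambda>\<omega>. (h (X j \<omega>) - a)\<^sup>2))"
    by (intro expectation_square_sum_indep fin centered int1 int2 mean)
  also have "\<dots> \<le> (\<Sum>j\<in>I. expectation (\<lambda>\<omega>. (2 * B)\<^sup>2))"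
    by (intro sum_mono integral_mono) (use int2 sq_le in auto)
  also have "sqrt \<dots> = 2 * B * sqrt (card I)"
    using B by (simp add: prob_space real_sqrt_mult)
  finally have H: "expectation (\<lambda>\<omega>. \<bar>?H \<omega>\<bar>) \<le> 2 * B * sqrt (card I)"
    by simp

  have R_int1: "integrable M (\<lambda>\<omega>. \<bar>r (X j \<omega>)\<bar>)" if "j \<in> I" for j
    using transfer(2)[OF that that, of r] r_int by simp
  have R_int: "integrable M ?R"
    using R_int1 by (intro Bochner_Integration.integrable_sum) auto
  have "expectation ?R = (\<Sum>j\<in>I. expectation (\<lambda>\<omega>. \<bar>r (X j \<omega>)\<bar>) + \<bar>b\<bar>)"
    using R_int1 by (simp add: Bochner_Integration.integral_sum prob_space)
  also have "\<dots> = (\<Sum>j\<in>I. \<tau> + \<bar>b\<bar>)"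
    using transfer(1)[of _ "\<lambda>t. \<bar>r t\<bar>"] by (intro sum.cong) (auto simp: \<tau>)
  also have "\<dots> \<le> (\<Sum>j\<in>I. 2 * \<tau>)"
    using b_bound by (intro sum_mono) auto
  finally have R: "expectation ?R \<le> 2 * real (card I) * \<tau>"
    by simp

  have "\<bar>\<Sum>j\<in>I. (X j \<omega> - (\<integral>t. t \<partial>N))\<bar> \<le> \<bar>?H \<omega>\<bar> + ?R \<omega>" for \<omega>
  proof -
    have "(\<Sum>j\<in>I. (X j \<omega> - (\<integral>t. t \<partial>N))) = ?H \<omega> + (\<Sum>j\<in>I. (r (X j \<omega>) - b))"
      unfolding ab sum.distrib[symmetric]
      by (intro sum.cong refl) (use hr in \<open>smt (verit)\<close>)
    also have "\<bar>\<dots>\<bar> \<le> \<bar>?H \<omega>\<bar> + \<bar>\<Sum>j\<in>I. (r (X j \<omega>) - b)\<bar>"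
      by (rule abs_triangle_ineq)
    also have "\<bar>\<Sum>j\<in>I. (r (X j \<omega>) - b)\<bar> \<le> ?R \<omega>"
      by (rule order.trans[OF sum_abs]) (intro sum_mono, linarith)
    finally show ?thesis by simp
  qed
  \<comment> \<open>\<open>integral_mono'\<close> asks for integrability and nonnegativity of the
    majorant only.\<close>
  then have "expectation (\<lambda>\<omega>. \<bar>\<Sum>j\<in>I. (X j \<omega> - (\<integral>t. t \<partial>N))\<bar>) \<le> expectation (\<lambda>\<omega>. \<bar>?H \<omega>\<bar> + ?R \<omega>)"
    by (intro integral_mono')
       (use H_int R_int in \<open>auto intro!: Bochner_Integration.integrable_add add_nonneg_nonneg sum_nonneg\<close>)
  also have "\<dots> = expectation (\<lambda>\<omega>. \<bar>?H \<omega>\<bar>) + expectation ?R"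
    by (rule Bochner_Integration.integral_add) (use H_int R_int in auto)
  finally show ?thesis
    using H R by linarith
qed

text \<open>Dominated convergence with dominating function |t|: at each point the integrand is 0
  once n reaches |t|.\<close>

lemma (in real_distribution) truncated_first_moment_tendsto_0:
  assumes "integrable M (\<lambda>t. t)"
  shows "(\<lambda>n. \<integral>t. \<bar>t\<bar> * indicator {t. \<bar>t\<bar> > real n} t \<partial>M) \<longlonglongrightarrow> 0"
proof -
  have "(\<lambda>n. \<integral>t. \<bar>t\<bar> * indicator {t. \<bar>t\<bar> > real n} t \<partial>M) \<longlonglongrightarrow> (\<integral>t. 0 \<partial>M)"
  proof (rule integral_dominated_convergence[where w = "\<lambda>t. \<bar>t\<bar>"])
    have "(\<lambda>n. \<bar>t\<bar> * indicator {t. \<bar>t\<bar> > real n} t) \<longlonglongrightarrow> 0" for t :: real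
    proof (rule tendsto_eventually)
      obtain k :: nat where "\<bar>t\<bar> \<le> k"
        using real_arch_simple by blast
      then show "\<forall>\<^sub>F n in sequentially. \<bar>t\<bar> * indicator {t. \<bar>t\<bar> > real n} t = 0"
        by (intro eventually_sequentiallyI[of k]) (auto simp: indicator_def)
    qed
    then show "AE t in M. (\<lambda>n. \<bar>t\<bar> * indicator {t. \<bar>t\<bar> > real n} t) \<longlonglongrightarrow> 0"
      by simp
    show "AE t in M. norm (\<bar>t\<bar> * indicator {t. \<bar>t\<bar> > real n} t) \<le> \<bar>t\<bar>" for n
      by (rule AE_I2) (simp add: indicator_def)
    show "(\<lambda>t. \<bar>t\<bar> * indicator {t. \<bar>t\<bar> > real n} t) \<in> borel_measurable M" for n
      by measurable
  qed (use assms in simp_all)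
  then show ?thesis by simp
qed

text \<open>The probability space may change with d and nothing relates different rows, so the law
  is stated for an array whose entries share the law \<open>N\<close>. Markov's inequality turns the
  first-moment bound on the centered sum into a bound on the probability.\<close>

theorem weak_law_of_large_numbers_rows:
  fixes X :: "nat \<Rightarrow> nat \<Rightarrow> 'a \<Rightarrow> real" and N :: "real measure" and \<epsilon> :: real
  assumes M: "\<And>d. prob_space (M d)"
    and ind: "\<And>d. prob_space.indep_vars (M d) (\<lambda>_. borel) (X d) {1..d}"
    and distr: "\<And>d j. j \<in> {1..d} \<Longrightarrow> distr (M d) borel (X d j) = N"
    and N: "real_distribution N" "integrable N (\<lambda>t. t)" and "\<epsilon> > 0"
  shows "(\<lambda>d. \<P>(\<omega> in M d. \<bar>\<Sum>j=1..d. (X d j \<omega> - (\<integral>t. t \<partial>N))\<bar> \<ge> \<epsilon> * d)) \<longlonglongrightarrow> 0"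
proof -
  let ?S = "\<lambda>d \<omega>. \<Sum>j=1..d. (X d j \<omega> - (\<integral>t. t \<partial>N))"
  let ?P = "\<lambda>d. \<P>(\<omega> in M d. \<bar>?S d \<omega>\<bar> \<ge> \<epsilon> * d)"
  let ?\<tau> = "\<lambda>n. \<integral>t. \<bar>t\<bar> * indicator {t. \<bar>t\<bar> > real n} t \<partial>N"
  \<comment> \<open>The truncation level n is free. The case d = 0 is excluded because the event is
    then the whole space.\<close>
  have bound: "?P d \<le> 2 * real n / \<epsilon> / sqrt d + 2 * ?\<tau> n / \<epsilon>" if "d \<ge> 1" for d n :: nat
  proof -
    interpret prob_space "M d" by (rule M)
    have X: "random_variable borel (X d j)" if "j \<in> {1..d}" for j
      using ind[of d] that by (auto simp: indep_vars_def)
    have "integrable (M d) (X d j)" if "j \<in> {1..d}" for j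
      using integrable_iff_of_distr_ident[OF X[OF that] distr[OF that]] N(2) by simp
    then have S_int: "integrable (M d) (?S d)"
      by (intro Bochner_Integration.integrable_sum) auto
    have "?P d \<le> expectation (\<lambda>\<omega>. \<bar>?S d \<omega>\<bar>) / (\<epsilon> * d)"
      by (rule integral_Markov_inequality_measure[where A = "{}"])
         (use S_int that \<open>\<epsilon> > 0\<close> in auto)
    also have "\<dots> \<le> (2 * real n * sqrt (real (card {1..d})) + 2 * real (card {1..d}) * ?\<tau> n) / (\<epsilon> * d)"
      by (rule divide_right_mono[OF expectation_abs_centered_sum_le[OF _ ind distr N]])
         (use \<open>\<epsilon> > 0\<close> in simp_all)
    also have "\<dots> = 2 * real n / \<epsilon> * (sqrt d / d) + 2 * ?\<tau> n / \<epsilon>"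
      using that \<open>\<epsilon> > 0\<close> by (simp add: add_divide_distrib)
    also have "sqrt d / d = 1 / sqrt d"
      by (simp add: sqrt_divide_self_eq inverse_eq_divide)
    finally show ?thesis by simp
  qed
  show ?thesis
  proof (rule LIMSEQ_I)
    fix e :: real assume "e > 0"
    \<comment> \<open>The truncation level is fixed before d: the tail then costs less than e / 2
      for every d, and the remaining term, of order 1 / sqrt d, falls below e / 2 for large
      d.\<close>
    have "\<forall>\<^sub>F n in sequentially. ?\<tau> n < e * \<epsilon> / 4"
      by (rule order_tendstoD[OF real_distribution.truncated_first_moment_tendsto_0[OF N]])
         (use \<open>e > 0\<close> \<open>\<epsilon> > 0\<close> in simp)
    then obtain n where n: "?\<tau> n < e * \<epsilon> / 4"
      by (meson eventually_sequentially order.refl)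
    have "(\<lambda>d. 2 * real n / \<epsilon> / sqrt d) \<longlonglongrightarrow> 0"
      by (intro tendsto_divide_0[OF tendsto_const] filterlim_at_top_imp_at_infinity
          filterlim_compose[OF sqrt_at_top filterlim_real_sequentially])
    then have "\<forall>\<^sub>F d in sequentially. 2 * real n / \<epsilon> / sqrt d < e / 2"
      by (rule order_tendstoD) (use \<open>e > 0\<close> in simp)
    then have "\<forall>\<^sub>F d in sequentially. norm (?P d - 0) < e"
      using eventually_ge_at_top[of 1]
    proof eventually_elim
      case (elim d)
      have "2 * ?\<tau> n / \<epsilon> < e / 2"
        using n \<open>\<epsilon> > 0\<close> by (simp add: field_simps)
      then show ?case
        using elim bound[of d n] by (simp add: measure_nonneg)
    qed
    then show "\<exists>d0. \<forall>d\<ge>d0. norm (?P d - 0) < e"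
      by (simp add: eventually_sequentially)
  qed
qed

section \<open>Comparison with a single competitor\<close>

lemma self_inner_product_dominates:
  fixes D :: "real measure" and M :: "nat \<Rightarrow> 'a measure"
    and \<xi> :: "nat \<Rightarrow> 'k \<Rightarrow> nat \<Rightarrow> 'a \<Rightarrow> real"
  assumes D: "real_distribution D" "integrable D (\<lambda>t. t)" "(\<integral>t. t \<partial>D) = 0"
    and M: "\<And>d. prob_space (M d)"
    and ind: "\<And>d. prob_space.indep_vars (M d) (\<lambda>_. borel) (\<lambda>(k, j). \<xi> d k j) (K \<times> {1..d})"
    and distr: "\<And>d k j. k \<in> K \<Longrightarrow> j \<in> {1..d} \<Longrightarrow> distr (M d) borel (\<xi> d k j) = D"
    and ik: "i \<in> K" "k \<in> K" "i \<noteq> k"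
  shows "(\<lambda>d. \<P>(\<omega> in M d. (\<Sum>j=1..d. \<xi> d i j \<omega> * \<xi> d i j \<omega>) < (\<Sum>j=1..d. \<xi> d i j \<omega> * \<xi> d k j \<omega>)))
           \<longlonglongrightarrow> 0"
    (is "(\<lambda>d. ?P d) \<longlonglongrightarrow> 0")
proof -
  interpret D: real_distribution D by fact
  have rv: "\<xi> d l j \<in> borel_measurable (M d)" if "l \<in> K" "j \<in> {1..d}" for d l j
    using ind[of d] that unfolding prob_space.indep_vars_def[OF M] by fastforce
  define c where "c = (\<integral>t. min (t\<^sup>2) 1 \<partial>D)"
  have c_int: "integrable D (\<lambda>t. min (t\<^sup>2) 1)"
    by (rule D.integrable_const_bound[where B = 1]) auto
  have "c \<ge> 0"
    unfolding c_def by (rule integral_nonneg_AE) auto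
  show ?thesis
  proof (cases "c = 0")
    case True
    then have "AE t in D. min (t\<^sup>2) 1 = 0"
      unfolding c_def using integral_nonneg_eq_0_iff_AE[OF c_int] by simp
    \<comment> \<open>The truncated square vanishes only at 0, so \<open>D\<close> is concentrated
      there.\<close>
    then have D0: "AE t in D. t = 0"
      by (rule AE_mp) (auto simp: min_def)
    have "?P d = 0" for d
    proof -
      have "AE \<omega> in M d. \<xi> d i j \<omega> = 0" if "j \<in> {1..d}" for j
        using D0 unfolding distr[OF ik(1) that, symmetric] by (rule AE_distrD[OF rv[OF ik(1) that]])
      then have "AE \<omega> in M d. \<forall>j\<in>{1..d}. \<xi> d i j \<omega> = 0"
        by (simp add: AE_finite_all)
      then have "AE \<omega> in M d. \<not> (\<Sum>j=1..d. \<xi> d i j \<omega> * \<xi> d i j \<omega>) < (\<Sum>j=1..d. \<xi> d i j \<omega> * \<xi> d k j \<omega>)"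
        by (rule AE_mp) (auto intro!: AE_I2)
      then show ?thesis
        by (intro measure_eq_0_null_sets AE_iff_null_sets[THEN iffD2])
           (use rv ik in \<open>auto intro!: borel_measurable_sum borel_measurable_times\<close>)
    qed
    then show ?thesis by simp
  next
    case False
    with \<open>c \<ge> 0\<close> have "c > 0" by simp
    define g :: "real \<times> real \<Rightarrow> real" where "g = (\<lambda>(s, t). min (s\<^sup>2) 1 - s * t)"
    have g[measurable]: "g \<in> borel_measurable (borel \<Otimes>\<^sub>M borel)"
      unfolding g_def by measurable
    \<comment> \<open>The weak law needs one law common to all rows and entries. By independence the
      pair of j-th coordinates has law \<open>D \<Otimes>\<^sub>M D\<close>, so \<open>N\<close> is
      the law of every \<open>Z d j\<close>.\<close>
    define N where "N = distr (D \<Otimes>\<^sub>M D) borel g"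
    define Z where "Z = (\<lambda>d j \<omega>. g (\<xi> d i j \<omega>, \<xi> d k j \<omega>))"
    have indep: "prob_space.indep_var (M d) borel (\<xi> d i j) borel (\<xi> d k j)" if "j \<in> {1..d}" for d j
      using prob_space.indep_var_of_indep_vars[OF M ind, where a = "(i, j)" and b = "(k, j)"] that ik by auto
    have Z_rv: "Z d j \<in> borel_measurable (M d)" if "j \<in> {1..d}" for d j
      unfolding Z_def
      by (rule measurable_compose[OF _ g]) (use rv ik that in \<open>auto intro!: measurable_Pair\<close>)
    have Z_distr: "distr (M d) borel (Z d j) = N" if j: "j \<in> {1..d}" for d j
    proof -
      have "D \<Otimes>\<^sub>M D = distr (M d) (borel \<Otimes>\<^sub>M borel) (\<lambda>\<omega>. (\<xi> d i j \<omega>, \<xi> d k j \<omega>))"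
        using indep[OF j] distr[OF ik(1) j] distr[OF ik(2) j]
        by (simp add: prob_space.indep_var_distribution_eq[OF M])
      then show ?thesis
        unfolding N_def Z_def
        using rv[OF ik(1) j] rv[OF ik(2) j] by (simp add: distr_distr comp_def)
    qed
    \<comment> \<open>\<open>Z d j\<close> depends only on the block of indices (i, j) and (k, j).
      These blocks are disjoint for different j, so independence passes to the whole family.\<close>
    have Z_ind: "prob_space.indep_vars (M d) (\<lambda>_. borel) (Z d) {1..d}" for d
    proof -
      interpret prob_space "M d" by (rule M)
      have "indep_vars (\<lambda>_. borel)
          (\<lambda>j \<omega>. (\<lambda>f. g (f (i, j), f (k, j))) (\<lambda>p\<in>{(i, j), (k, j)}. (\<lambda>(k, j). \<xi> d k j) p \<omega>)) {1..d}"
        by (rule indep_vars_compose2[OF indep_vars_restrict[OF ind]])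
           (use ik in \<open>auto simp: disjoint_family_on_def
              intro!: measurable_compose[OF _ g] measurable_Pair measurable_component_singleton\<close>)
      then show ?thesis
        by (simp add: Z_def)
    qed
    \<comment> \<open>Since every \<open>Z d j\<close> has law \<open>N\<close>, the properties of
      \<open>N\<close> can be read off at d = j = 1, the first row that has an entry.\<close>
    have N_real: "real_distribution N"
      using prob_space.real_distribution_distr[OF M Z_rv, of 1 1] Z_distr[of 1 1] by simp
    have N_int: "integrable N (\<lambda>t. t)" and N_mean: "(\<integral>t. t \<partial>N) = c"
    proof -
      interpret prob_space "M 1" by (rule M)
      have \<xi>: "integrable (M 1) (\<xi> 1 l 1)" "expectation (\<xi> 1 l 1) = 0" if "l \<in> K" for l
        using integrable_iff_of_distr_ident[OF rv distr, of l 1 1]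
          integral_eq_of_distr_ident[OF rv distr, of l 1 1] that D(2,3) by simp_all
      \<comment> \<open>Independence makes the product integrable from first moments alone. The
        square has no such help, which is why it is truncated in \<open>g\<close>.\<close>
      have prod: "integrable (M 1) (\<lambda>\<omega>. \<xi> 1 i 1 \<omega> * \<xi> 1 k 1 \<omega>)"
        "expectation (\<lambda>\<omega>. \<xi> 1 i 1 \<omega> * \<xi> 1 k 1 \<omega>) = 0"
        using indep_var_integrable[OF indep] indep_var_lebesgue_integral[OF indep] \<xi> ik by auto
      have sq: "integrable (M 1) (\<lambda>\<omega>. min ((\<xi> 1 i 1 \<omega>)\<^sup>2) 1)"
        "expectation (\<lambda>\<omega>. min ((\<xi> 1 i 1 \<omega>)\<^sup>2) 1) = c"
        unfolding c_def using ik c_int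
        by (subst integrable_iff_of_distr[OF rv distr] integral_eq_of_distr[OF rv distr]; simp)+
      have Z: "Z 1 1 = (\<lambda>\<omega>. min ((\<xi> 1 i 1 \<omega>)\<^sup>2) 1 - \<xi> 1 i 1 \<omega> * \<xi> 1 k 1 \<omega>)"
        by (simp add: Z_def g_def)
      have "integrable (M 1) (Z 1 1)" "expectation (Z 1 1) = c"
        unfolding Z using prod sq by auto
      then show "integrable N (\<lambda>t. t)" "(\<integral>t. t \<partial>N) = c"
        using integrable_iff_of_distr_ident[OF Z_rv Z_distr, of 1 1]
          integral_eq_of_distr_ident[OF Z_rv Z_distr, of 1 1] by simp_all
    qed
    have lim: "(\<lambda>d. \<P>(\<omega> in M d. \<bar>\<Sum>j=1..d. (Z d j \<omega> - c)\<bar> \<ge> c * d)) \<longlonglongrightarrow> 0"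
      using weak_law_of_large_numbers_rows[OF M Z_ind Z_distr N_real N_int \<open>c > 0\<close>] N_mean by simp
    have le: "?P d \<le> \<P>(\<omega> in M d. \<bar>\<Sum>j=1..d. (Z d j \<omega> - c)\<bar> \<ge> c * d)" for d
    proof -
      interpret prob_space "M d" by (rule M)
      \<comment> \<open>The sum of the \<open>Z d j\<close> has mean \<open>c * d\<close>, so being
        negative forces a deviation of at least \<open>c * d\<close>. Hence the weak law is applied
        with deviation level \<open>c\<close>.\<close>
      have "\<bar>\<Sum>j=1..d. (Z d j \<omega> - c)\<bar> \<ge> c * d"
        if "(\<Sum>j=1..d. \<xi> d i j \<omega> * \<xi> d i j \<omega>) < (\<Sum>j=1..d. \<xi> d i j \<omega> * \<xi> d k j \<omega>)" for \<omega>
      proof -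
        \<comment> \<open>Truncating the square only lowers each term.\<close>
        have "(\<Sum>j=1..d. Z d j \<omega>) \<le> (\<Sum>j=1..d. \<xi> d i j \<omega> * \<xi> d i j \<omega> - \<xi> d i j \<omega> * \<xi> d k j \<omega>)"
          by (intro sum_mono) (auto simp: Z_def g_def power2_eq_square)
        also have "\<dots> < 0"
          using that by (simp add: sum_subtractf)
        finally show ?thesis
          by (simp add: sum_subtractf mult.commute)
      qed
      moreover have "(\<lambda>\<omega>. \<bar>\<Sum>j=1..d. (Z d j \<omega> - c)\<bar>) \<in> borel_measurable (M d)"
        using Z_rv by (intro borel_measurable_abs borel_measurable_sum borel_measurable_diff) auto
      ultimately show ?thesis
        by (intro finite_measure_mono) auto
    qed
    show ?thesis
      by (rule tendsto_sandwich[OF _ _ tendsto_const lim]) (use le in auto)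
  qed
qed

section \<open>Union bound over the competitors\<close>

theorem theorem1p1:
  fixes m :: nat
    and D :: "real measure"
    and M :: "nat \<Rightarrow> 'a measure"
    and \<xi> :: "nat \<Rightarrow> nat \<Rightarrow> nat \<Rightarrow> 'a \<Rightarrow> real"
    and x :: "nat \<Rightarrow> nat \<Rightarrow> 'a \<Rightarrow> nat \<Rightarrow> real"
    and i :: nat
  assumes "m \<ge> 1"
    and "real_distribution D"
    and "integrable D (\<lambda>t. t)"
    and "(\<integral>t. t \<partial>D) = 0"
    and "\<And>d. prob_space (M d)"
    and "\<And>d. prob_space.indep_vars (M d) (\<lambda>_. borel) (\<lambda>(k, j). \<xi> d k j) ({1..m} \<times> {1..d})"
    and "\<And>d k j. k \<in> {1..m} \<Longrightarrow> j \<in> {1..d} \<Longrightarrow> distr (M d) borel (\<xi> d k j) = D"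
    and "\<And>d k \<omega>. x d k \<omega> = vec_Rd d (\<lambda>j. \<xi> d k j \<omega>)"
    and "i \<in> {1..m}"
  shows "(\<lambda>d. \<P>(\<omega> in M d.
            is_arg_max (\<lambda>v. inner_Rd d (x d i \<omega>) v) (\<lambda>v. v \<in> (\<lambda>k. x d k \<omega>) ` {1..m}) (x d i \<omega>)))
          \<longlonglongrightarrow> 1"
proof -
  let ?bad = "\<lambda>d k. {\<omega> \<in> space (M d).
    (\<Sum>j=1..d. \<xi> d i j \<omega> * \<xi> d i j \<omega>) < (\<Sum>j=1..d. \<xi> d i j \<omega> * \<xi> d k j \<omega>)}"
  let ?good = "\<lambda>d. {\<omega> \<in> space (M d).
    is_arg_max (\<lambda>v. inner_Rd d (x d i \<omega>) v) (\<lambda>v. v \<in> (\<lambda>k. x d k \<omega>) ` {1..m}) (x d i \<omega>)}"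
  have rv: "\<xi> d k j \<in> borel_measurable (M d)" if "k \<in> {1..m}" "j \<in> {1..d}" for d k j
    using assms(6)[of d] that unfolding prob_space.indep_vars_def[OF assms(5)] by fastforce
  have bad: "?bad d k \<in> sets (M d)" if "k \<in> {1..m}" for d k
  proof -
    have "(\<lambda>\<omega>. \<Sum>j=1..d. \<xi> d i j \<omega> * \<xi> d l j \<omega>) \<in> borel_measurable (M d)" if "l \<in> {1..m}" for l
      using rv that assms(9) by (intro borel_measurable_sum borel_measurable_times) auto
    then show ?thesis
      using that assms(9) by measurable
  qed
  \<comment> \<open>The restriction in \<open>vec_Rd\<close> disappears because the inner product
    sums over \<open>{1..d}\<close> only.\<close>
  have inner: "inner_Rd d (x d k \<omega>) (x d l \<omega>) = (\<Sum>j=1..d. \<xi> d k j \<omega> * \<xi> d l j \<omega>)" for d k l \<omega>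
    by (simp add: inner_Rd_def vec_Rd_def assms(8))
  \<comment> \<open>\<open>is_arg_max\<close> forbids only strictly larger values, so ties and
    coinciding vectors do no harm and failure means a strict defeat by some index k.\<close>
  have good: "?good d = space (M d) - (\<Union>k\<in>{1..m}. ?bad d k)" for d
    using assms(9) by (auto simp: is_arg_max_def inner)
  \<comment> \<open>An inequality suffices here, since the probability is squeezed from above by
    1.\<close>
  have lower: "measure (M d) (?good d) \<ge> 1 - (\<Sum>k\<in>{1..m}. measure (M d) (?bad d k))" for d
  proof -
    interpret prob_space "M d" by (rule assms(5))
    have "prob (\<Union>k\<in>{1..m}. ?bad d k) \<le> (\<Sum>k\<in>{1..m}. prob (?bad d k))"
      by (rule finite_measure_subadditive_finite) (use bad in auto)
    moreover have "prob (?good d) = 1 - prob (\<Union>k\<in>{1..m}. ?bad d k)"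
      unfolding good by (rule prob_compl) (use bad in auto)
    ultimately show ?thesis by simp
  qed
  have "(\<lambda>d. measure (M d) (?bad d k)) \<longlonglongrightarrow> 0" if "k \<in> {1..m}" for k
  \<comment> \<open>For k = i the event compares a sum strictly with itself and is empty.\<close>
  proof (cases "k = i")
    case False
    then show ?thesis
      using self_inner_product_dominates[OF assms(2-7) assms(9) that] by simp
  qed simp
  then have "(\<lambda>d. 1 - (\<Sum>k\<in>{1..m}. measure (M d) (?bad d k))) \<longlonglongrightarrow> 1 - (\<Sum>k\<in>{1..m}. 0)"
    by (intro tendsto_intros)
  then have "(\<lambda>d. 1 - (\<Sum>k\<in>{1..m}. measure (M d) (?bad d k))) \<longlonglongrightarrow> 1"
    by simp
  then show ?thesis
    by (rule tendsto_sandwich[OF _ _ _ tendsto_const, rotated 2])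
       (use lower prob_space.prob_le_1[OF assms(5)] in auto)
qed

end
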